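(* Let $A$ and $B$ be Abelian heaps. Together with the maps $\iota_A:A\to A\boxplus B$, $a\mapsto a$, and $\iota_B:B\to A\boxplus B$, $b\mapsto b$ (sending an element to the class of the corresponding one-letter word), the heap $A\boxplus B$ is a coproduct of $A$ and $B$ in the category of Abelian heaps. That is, $\iota_A,\iota_B$ are heap morphisms and for every Abelian heap $H$ and all heap morphisms $\varphi:A\to H$, $\psi:B\to H$ there is a unique heap morphism $\varphi\boxplus\psi:A\boxplus B\to H$ with $(\varphi\boxplus\psi)\circ\iota_A=\varphi$ and $(\varphi\boxplus\psi)\circ\iota_B=\psi$.
   Context: A heap is a set $H$ (possibly empty) with a ternary operation $[-,-,-]$ such that $[[a,b,c],d,e]=[a,b,[c,d,e]]$ and $[a,b,b]=a=[b,b,a]$ for all $a,b,c,d,e\in H$. It is Abelian if $[a,b,c]=[c,b,a]$ for all $a,b,c$. Heap morphisms are maps preserving the ternary operation. Free Abelian heap $\mathcal{A}(X)$ on a set $X$: a symmetric word is the set of all words obtained from an odd-length word $x_1y_1x_2\ldots y_nx_{n+1}$ in $X$ by arbitrarily permuting the letters $x_i$ in odd positions among themselves and the letters $y_j$ in even positions among themselves. It is reduced if none of the words in it has two equal consecutive letters. Every symmetric word can be pruned to a unique reduced one by repeatedly removing pairs of equal consecutive letters from the words in it. $\mathcal{A}(X)$ is the set of reduced symmetric words, with the ternary operation given by concatenating representatives and pruning. If $S$ is a non-empty sub-heap of an Abelian heap $H$, $H/S$ is the heap of classes of the relation $a\sim_S b$ iff $[a,b,s]\in S$ for some (equivalently all)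 $s\in S$, with the induced operation. Direct sum: for Abelian heaps $A,B$ with operations $[-,-,-]_A$, $[-,-,-]_B$, let $A\sqcup B$ be the disjoint union of sets, fix any $e\in\mathcal{A}(A\sqcup B)$ and let $C_e$ be the sub-heap of $\mathcal{A}(A\sqcup B)$ generated by all elements $[[a,a',a''],[a,a',a'']_A,e]$ and $[[b,b',b''],[b,b',b'']_B,e]$ with $a,a',a''\in A$, $b,b',b''\in B$, where the undecorated brackets are taken in $\mathcal{A}(A\sqcup B)$. Then $A\boxplus B:=\mathcal{A}(A\sqcup B)/C_e$ (and $A\boxplus B:=\emptyset$ if $A=B=\emptyset$). *)

theory Defs
  imports "HOL-Combinatorics.Permutations" "HOL-Library.FuncSet"
begin

record 'a ternary =
  carrier :: "'a set"
  bracket :: "'a \<Rightarrow> 'a \<Rightarrow> 'a \<Rightarrow> 'a"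

locale heap =
  fixes H :: "'a ternary"
  assumes closed: "\<lbrakk>a \<in> carrier H; b \<in> carrier H; c \<in> carrier H\<rbrakk> \<Longrightarrow> bracket H a b c \<in> carrier H"
    and assoc: "\<lbrakk>a \<in> carrier H; b \<in> carrier H; c \<in> carrier H; d \<in> carrier H; e \<in> carrier H\<rbrakk>
      \<Longrightarrow> bracket H (bracket H a b c) d e = bracket H a b (bracket H c d e)"
    and right_cancel: "\<lbrakk>a \<in> carrier H; b \<in> carrier H\<rbrakk> \<Longrightarrow> bracket H a b b = a"
    and left_cancel: "\<lbrakk>a \<in> carrier H; b \<in> carrier H\<rbrakk> \<Longrightarrow> bracket H b b a = a"

locale abelian_heap = heap +
  assumes comm: "\<lbrakk>a \<in> carrier H; b \<in> carrier H; c \<in> carrier H\<rbrakk> \<Longrightarrow> bracket H a b c = bracket H c b a"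

definition heap_hom :: "'a ternary \<Rightarrow> 'b ternary \<Rightarrow> ('a \<Rightarrow> 'b) set" where
  "heap_hom H K = {f \<in> carrier H \<rightarrow> carrier K.
     \<forall>a\<in>carrier H. \<forall>b\<in>carrier H. \<forall>c\<in>carrier H.
       f (bracket H a b c) = bracket K (f a) (f b) (f c)}"

definition subheap :: "'a set \<Rightarrow> 'a ternary \<Rightarrow> bool" where
  "subheap S H \<longleftrightarrow> S \<subseteq> carrier H \<and> (\<forall>a\<in>S. \<forall>b\<in>S. \<forall>c\<in>S. bracket H a b c \<in> S)"

definition generated_subheap :: "'a ternary \<Rightarrow> 'a set \<Rightarrow> 'a set" where
  "generated_subheap H G = \<Inter> {S. subheap S H \<and> G \<subseteq> S}"

definition subheap_rel :: "'a ternary \<Rightarrow> 'a set \<Rightarrow> ('a \<times> 'a) set" where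
  "subheap_rel H S = {(a, b). a \<in> carrier H \<and> b \<in> carrier H \<and> (\<exists>s\<in>S. bracket H a b s \<in> S)}"

text \<open>The unions in the brackets of the quotient and of the free Abelian heap range over sets that
  do not depend on the chosen representatives.\<close>

definition quotient_heap :: "'a ternary \<Rightarrow> 'a set \<Rightarrow> 'a set ternary" where
  "quotient_heap H S =
    \<lparr>carrier = carrier H // subheap_rel H S,
     bracket = (\<lambda>X Y Z. \<Union>x\<in>X. \<Union>y\<in>Y. \<Union>z\<in>Z. subheap_rel H S `` {bracket H x y z})\<rparr>"

text \<open>List indices start at 0, so the letters in odd positions of a word are those with an even
  index.\<close>

definition symword :: "'a list \<Rightarrow> 'a list set" where
  "symword w = {permute_list p w | p. p permutes {..<length w} \<and> (\<forall>i. even (p i) \<longleftrightarrow> even i)}"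

definition symmetric_words :: "'a set \<Rightarrow> 'a list set set" where
  "symmetric_words X = {symword w | w. odd (length w) \<and> set w \<subseteq> X}"

definition reduced :: "'a list set \<Rightarrow> bool" where
  "reduced W \<longleftrightarrow> (\<forall>w\<in>W. distinct_adj w)"

definition prune_step :: "'a list set \<Rightarrow> 'a list set \<Rightarrow> bool" where
  "prune_step W W' \<longleftrightarrow> (\<exists>u x v. u @ [x, x] @ v \<in> W \<and> W' = symword (u @ v))"

definition prune :: "'a list set \<Rightarrow> 'a list set" where
  "prune W = (THE R. prune_step\<^sup>*\<^sup>* W R \<and> reduced R)"

text \<open>In a concatenation of three odd-length words the parity of the positions in the middle word
  is exchanged, so its odd-position letters become even-position letters and vice versa.\<close>

definition free_abelian_heap :: "'a set \<Rightarrow> 'a list set ternary" where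
  "free_abelian_heap X =
    \<lparr>carrier = {W \<in> symmetric_words X. reduced W},
     bracket = (\<lambda>U V W. prune (\<Union>u\<in>U. \<Union>v\<in>V. \<Union>w\<in>W. symword (u @ v @ w)))\<rparr>"

definition sum_free :: "'a ternary \<Rightarrow> 'b ternary \<Rightarrow> ('a + 'b) list set ternary" where
  "sum_free A B = free_abelian_heap (carrier A <+> carrier B)"

definition sum_subheap ::
  "'a ternary \<Rightarrow> 'b ternary \<Rightarrow> ('a + 'b) list set \<Rightarrow> ('a + 'b) list set set" where
  "sum_subheap A B e = generated_subheap (sum_free A B)
    ({bracket (sum_free A B)
        (bracket (sum_free A B) (symword [Inl a]) (symword [Inl a']) (symword [Inl a'']))
        (symword [Inl (bracket A a a' a'')]) e
      | a a' a''. a \<in> carrier A \<and> a' \<in> carrier A \<and> a'' \<in> carrier A} \<union>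
     {bracket (sum_free A B)
        (bracket (sum_free A B) (symword [Inr b]) (symword [Inr b']) (symword [Inr b'']))
        (symword [Inr (bracket B b b' b'')]) e
      | b b' b''. b \<in> carrier B \<and> b' \<in> carrier B \<and> b'' \<in> carrier B})"

definition direct_sum ::
  "'a ternary \<Rightarrow> 'b ternary \<Rightarrow> ('a + 'b) list set \<Rightarrow> ('a + 'b) list set set ternary" where
  "direct_sum A B e =
    (if carrier A = {} \<and> carrier B = {} then \<lparr>carrier = {}, bracket = (\<lambda>_ _ _. undefined)\<rparr>
     else quotient_heap (sum_free A B) (sum_subheap A B e))"

definition inj_left ::
  "'a ternary \<Rightarrow> 'b ternary \<Rightarrow> ('a + 'b) list set \<Rightarrow> 'a \<Rightarrow> ('a + 'b) list set set" where
  "inj_left A B e a = subheap_rel (sum_free A B) (sum_subheap A B e) `` {symword [Inl a]}"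

definition inj_right ::
  "'a ternary \<Rightarrow> 'b ternary \<Rightarrow> ('a + 'b) list set \<Rightarrow> 'b \<Rightarrow> ('a + 'b) list set set" where
  "inj_right A B e b = subheap_rel (sum_free A B) (sum_subheap A B e) `` {symword [Inr b]}"

end

theory Submission
  imports Defs
begin

text \<open>Everything about a word that matters in the free Abelian heap is its net count: the function
  sending a letter to the number of its occurrences in odd positions minus the number of those in
  even positions. A symmetric word is a pair of multisets of letters, it is reduced exactly when the
  two multisets are disjoint, and a pair of disjoint multisets is recovered from its difference.
  Pruning preserves the net count, so it has a unique result (\<open>word_class_reduced_word\<close>), and two
  words of odd length represent the same element of the free heap iff their net counts agree
  (\<open>word_class_eq_iff\<close>). Concatenating three words of odd length produces the net count
  \<open>u - v + w\<close>, from which the axioms of an Abelian heap are immediate.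

  For the universal property of the free heap, let letters be sent to elements of an Abelian heap
  \<open>H\<close> and choose a base point \<open>z\<close> of \<open>H\<close>. Then \<open>H\<close> is an Abelian group with zero \<open>z\<close>, sum
  \<open>[a, z, b]\<close> and negative \<open>[z, a, z]\<close>, and a word is evaluated to the alternating sum of the images
  of its letters. A signed sum whose net count vanishes evaluates to \<open>z\<close>, because letters of
  opposite sign can be cancelled one pair at a time (\<open>eval_balanced\<close>); hence evaluation depends on
  the net count only and descends to a heap morphism (\<open>free_extension\<close>). Since the one-letter words
  generate the free heap, the morphism is determined by its values on them (\<open>free_hom_eqI\<close>).

  In the quotient by the sub-heap \<open>C\<close> generated by the relators \<open>[[a, a', a''], [a, a', a'']\<^sub>A, e]\<close>
  and their analogues for \<open>B\<close>, the inclusions of letters become heap morphisms, because \<open>e\<close> itself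
  lies in \<open>C\<close> (take \<open>a = a' = a''\<close>). Conversely, the extension of two morphisms
  \<open>\<phi>\<close> and \<open>\<psi>\<close> to the free heap sends every relator to the image of \<open>e\<close>, hence is constant on \<open>C\<close>,
  and a morphism that is constant on a sub-heap factors through the quotient
  (\<open>hom_factors_through_quotient\<close>). If both \<open>A\<close> and \<open>B\<close> are empty, so is the direct sum, and there
  is nothing to prove.\<close>

section \<open>Calculation in Abelian heaps\<close>

lemma (in heap) bracket_middle:
  assumes "a \<in> carrier H" "b \<in> carrier H" "c \<in> carrier H" "d \<in> carrier H" "e \<in> carrier H"
  shows "bracket H a (bracket H b c d) e = bracket H a d (bracket H c b e)"
proof -
  let ?m = "bracket H b c d"
  let ?y = "bracket H d ?m e"
  have m: "?m \<in> carrier H" and y: "?y \<in> carrier H"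
    using assms by (simp_all add: closed)
  \<comment> \<open>Write \<open>e\<close> as \<open>[?m, ?m, e]\<close> and reassociate, so that \<open>b\<close> and \<open>c\<close> come to the front.\<close>
  have "e = bracket H b c ?y"
    using assoc[of b c d ?m e] left_cancel[of e ?m] assms m by simp
  then have "bracket H c b e = ?y"
    using assoc[of c b b c ?y] assms y by (simp add: right_cancel left_cancel)
  then show ?thesis
    using assoc[of a d d ?m e] assms m by (simp add: right_cancel)
qed

section \<open>Quotients of Abelian heaps\<close>

context abelian_heap
begin

text \<open>Membership of \<open>[a, b, s]\<close> in a sub-heap does not depend on the choice of \<open>s\<close> in it.\<close>

lemma subheap_rel_iff:
  assumes "subheap S H" "s \<in> S"
  shows "(a, b) \<in> subheap_rel H S \<longleftrightarrow>
    a \<in> carrier H \<and> b \<in> carrier H \<and> bracket H a b s \<in> S"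
proof -
  have "bracket H a b s \<in> S"
    if "a \<in> carrier H" "b \<in> carrier H" "t \<in> S" "bracket H a b t \<in> S" for t
  proof -
    have st: "s \<in> carrier H" "t \<in> carrier H"
      using that assms by (auto simp: subheap_def)
    have "bracket H (bracket H a b t) t s \<in> S"
      using that assms by (auto simp: subheap_def)
    then show ?thesis
      using that st by (simp add: assoc left_cancel)
  qed
  then show ?thesis
    using assms(2) by (auto simp: subheap_rel_def)
qed

lemma equiv_subheap_rel:
  assumes "subheap S H" "S \<noteq> {}"
  shows "equiv (carrier H) (subheap_rel H S)"
proof -
  obtain s where s: "s \<in> S"
    using assms(2) by auto
  then have sH: "s \<in> carrier H"
    using assms(1) by (auto simp: subheap_def)
  note rel = subheap_rel_iff[OF assms(1) s]
  show ?thesis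
  proof (intro equivI refl_onI symI transI)
    show "subheap_rel H S \<subseteq> carrier H \<times> carrier H"
      by (auto simp: rel)
  next
    fix a assume "a \<in> carrier H"
    then show "(a, a) \<in> subheap_rel H S"
      using s sH by (simp add: rel left_cancel)
  next
    fix a b assume "(a, b) \<in> subheap_rel H S"
    then have ab: "a \<in> carrier H" "b \<in> carrier H" "bracket H a b s \<in> S"
      by (auto simp: rel)
    have "bracket H b a (bracket H a b s) = s"
      using assoc[of b a a b s] ab sH by (simp add: right_cancel left_cancel)
    then show "(b, a) \<in> subheap_rel H S"
      unfolding subheap_rel_iff[OF assms(1) ab(3)] using ab s by simp
  next
    fix a b c assume "(a, b) \<in> subheap_rel H S" "(b, c) \<in> subheap_rel H S"
    then have abc: "a \<in> carrier H" "b \<in> carrier H" "c \<in> carrier H"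
      "bracket H a b s \<in> S" "bracket H b c s \<in> S"
      by (auto simp: rel)
    have "bracket H a b (bracket H b c s) = bracket H a c s"
      using assoc[of a b b c s] abc sH by (simp add: right_cancel)
    moreover have "bracket H a b (bracket H b c s) \<in> S"
      using subheap_rel_iff[OF assms(1) abc(5), of a b] abc by (simp add: rel)
    ultimately show "(a, c) \<in> subheap_rel H S"
      using abc by (simp add: rel)
  qed
qed

lemma bracket_congruent:
  assumes "subheap S H" "S \<noteq> {}"
    and "(a, a') \<in> subheap_rel H S" "(b, b') \<in> subheap_rel H S" "(c, c') \<in> subheap_rel H S"
  shows "(bracket H a b c, bracket H a' b' c') \<in> subheap_rel H S"
proof -
  obtain s where s: "s \<in> S"
    using assms(2) by auto
  then have sH: "s \<in> carrier H"
    using assms(1) by (auto simp: subheap_def)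
  note rel = subheap_rel_iff[OF assms(1) s]
  note equiv = equiv_subheap_rel[OF assms(1,2)]
  have outer: "(bracket H x y z, bracket H x' y z) \<in> subheap_rel H S"
    if "(x, x') \<in> subheap_rel H S" and yz: "y \<in> carrier H" "z \<in> carrier H" for x x' y z
  proof -
    have x: "x \<in> carrier H" "x' \<in> carrier H" "bracket H x x' s \<in> S"
      using that by (auto simp: rel)
    have "bracket H (bracket H x y z) (bracket H x' y z) s =
        bracket H x y (bracket H z (bracket H x' y z) s)"
      using x yz sH by (simp add: assoc closed)
    also have "\<dots> = bracket H x y (bracket H y x' s)"
      using bracket_middle[of z x' y z s] x yz sH by (simp add: left_cancel closed)
    also have "\<dots> = bracket H x x' s"
      using assoc[of x y y x' s] x yz sH by (simp add: right_cancel)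
    finally show ?thesis
      using x yz by (simp add: rel closed)
  qed
  \<comment> \<open>The middle argument enters with a negative sign, so the relation is used in reverse.\<close>
  have inner: "(bracket H x y z, bracket H x y' z) \<in> subheap_rel H S"
    if "(y, y') \<in> subheap_rel H S" and xz: "x \<in> carrier H" "z \<in> carrier H" for x y y' z
  proof -
    have "(y', y) \<in> subheap_rel H S"
      using equiv that(1) by (auto elim: equivE dest: symD)
    then have y: "y \<in> carrier H" "y' \<in> carrier H" "bracket H y' y s \<in> S"
      by (auto simp: rel)
    have "bracket H (bracket H x y z) (bracket H x y' z) s =
        bracket H x y (bracket H z (bracket H x y' z) s)"
      using y xz sH by (simp add: assoc closed)
    also have "\<dots> = bracket H x y (bracket H y' x s)"
      using bracket_middle[of z x y' z s] y xz sH by (simp add: left_cancel closed)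
    also have "\<dots> = bracket H (bracket H y' y x) x s"
      using assoc[of x y y' x s] comm[of x y y'] y xz sH by simp
    also have "\<dots> = bracket H y' y s"
      using assoc[of y' y x x s] y xz sH by (simp add: left_cancel)
    finally show ?thesis
      using y xz by (simp add: rel closed)
  qed
  have mem: "a \<in> carrier H" "a' \<in> carrier H" "b \<in> carrier H" "b' \<in> carrier H"
    "c \<in> carrier H" "c' \<in> carrier H"
    using assms(3-5) by (auto simp: rel)
  have "(bracket H a b c, bracket H a' b c) \<in> subheap_rel H S"
    using outer assms(3) mem by simp
  moreover have "(bracket H a' b c, bracket H a' b' c) \<in> subheap_rel H S"
    using inner assms(4) mem by simp
  moreover have "(bracket H a' b' c, bracket H a' b' c') \<in> subheap_rel H S"
    using outer[OF assms(5), of b' a'] mem comm[of a' b'] by simp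
  ultimately show ?thesis
    using equiv unfolding equiv_def trans_def by blast
qed

text \<open>The union over all representatives that defines the bracket of the quotient is a union of equal
  classes.\<close>

lemma bracket_quotient:
  assumes "subheap S H" "S \<noteq> {}" "a \<in> carrier H" "b \<in> carrier H" "c \<in> carrier H"
  shows "bracket (quotient_heap H S) (subheap_rel H S `` {a}) (subheap_rel H S `` {b})
      (subheap_rel H S `` {c}) = subheap_rel H S `` {bracket H a b c}"
proof -
  note equiv = equiv_subheap_rel[OF assms(1,2)]
  have "subheap_rel H S `` {bracket H x y z} = subheap_rel H S `` {bracket H a b c}"
    if "x \<in> subheap_rel H S `` {a}" "y \<in> subheap_rel H S `` {b}" "z \<in> subheap_rel H S `` {c}"
    for x y z
    using that bracket_congruent[OF assms(1,2), of a x b y c z]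
    by (intro equiv_class_eq[OF equiv, symmetric]) auto
  moreover have "a \<in> subheap_rel H S `` {a}" "b \<in> subheap_rel H S `` {b}"
    "c \<in> subheap_rel H S `` {c}"
    using equiv_class_self[OF equiv] assms(3-5) by simp_all
  ultimately show ?thesis
    unfolding quotient_heap_def ternary.simps by blast
qed

lemma carrier_quotient: "carrier (quotient_heap H S) = carrier H // subheap_rel H S"
  by (simp add: quotient_heap_def)

lemma abelian_heap_quotient:
  assumes "subheap S H" "S \<noteq> {}"
  shows "abelian_heap (quotient_heap H S)"
proof
  note [simp] = bracket_quotient[OF assms] closed quotientI carrier_quotient
  let ?Q = "quotient_heap H S"
  fix a b c assume "a \<in> carrier ?Q" "b \<in> carrier ?Q" "c \<in> carrier ?Q"
  then show "bracket ?Q a b c \<in> carrier ?Q" "bracket ?Q a b c = bracket ?Q c b a"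
    by (auto simp: comm elim!: quotientE)
next
  note [simp] = bracket_quotient[OF assms] closed quotientI carrier_quotient
  let ?Q = "quotient_heap H S"
  fix a b c d e
  assume "a \<in> carrier ?Q" "b \<in> carrier ?Q" "c \<in> carrier ?Q" "d \<in> carrier ?Q" "e \<in> carrier ?Q"
  then show "bracket ?Q (bracket ?Q a b c) d e = bracket ?Q a b (bracket ?Q c d e)"
    by (auto simp: assoc elim!: quotientE)
next
  note [simp] = bracket_quotient[OF assms] closed quotientI carrier_quotient
  let ?Q = "quotient_heap H S"
  fix a b
  assume "a \<in> carrier ?Q" "b \<in> carrier ?Q"
  then show "bracket ?Q a b b = a" "bracket ?Q b b a = a"
    by (auto simp: left_cancel right_cancel elim!: quotientE)
qed

lemma quotient_map_hom:
  assumes "subheap S H" "S \<noteq> {}"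
  shows "(\<lambda>a. subheap_rel H S `` {a}) \<in> heap_hom H (quotient_heap H S)"
  using bracket_quotient[OF assms] by (auto simp: heap_hom_def carrier_quotient intro: quotientI)

lemma hom_factors_through_quotient:
  assumes "subheap S H" "S \<noteq> {}" "heap K" "f \<in> heap_hom H K"
    and const: "\<And>s t. s \<in> S \<Longrightarrow> t \<in> S \<Longrightarrow> f s = f t"
  obtains h where "h \<in> heap_hom (quotient_heap H S) K"
    "h \<in> extensional (carrier (quotient_heap H S))"
    "\<And>a. a \<in> carrier H \<Longrightarrow> h (subheap_rel H S `` {a}) = f a"
proof -
  interpret K: heap K by fact
  note equiv = equiv_subheap_rel[OF assms(1,2)]
  obtain s where s: "s \<in> S"
    using assms(2) by auto
  then have sH: "s \<in> carrier H"
    using assms(1) by (auto simp: subheap_def)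
  have f_carrier: "f a \<in> carrier K" if "a \<in> carrier H" for a
    using assms(4) that by (auto simp: heap_hom_def)
  have f_bracket: "f (bracket H a b c) = bracket K (f a) (f b) (f c)"
    if "a \<in> carrier H" "b \<in> carrier H" "c \<in> carrier H" for a b c
    using assms(4) that by (auto simp: heap_hom_def)
  have f_eq: "f a = f b" if "(a, b) \<in> subheap_rel H S" for a b
  proof -
    have ab: "a \<in> carrier H" "b \<in> carrier H" "bracket H a b s \<in> S"
      using that by (auto simp: subheap_rel_iff[OF assms(1) s])
    then have "bracket K (f a) (f b) (f s) = f s"
      using const[OF ab(3) s] f_bracket sH by simp
    \<comment> \<open>From \<open>[f a, f b, f s] = f s\<close>, cancel \<open>f s\<close>.\<close>
    then have "f b = bracket K (bracket K (f a) (f b) (f s)) (f s) (f b)"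
      using f_carrier ab(1,2) sH by (simp add: K.left_cancel)
    also have "\<dots> = f a"
      using f_carrier ab(1,2) sH by (simp add: K.assoc K.left_cancel K.right_cancel)
    finally show ?thesis by simp
  qed
  \<comment> \<open>Outside the carrier \<open>restrict\<close> gives the value that extensionality demands.\<close>
  define h where "h = restrict (\<lambda>X. f (SOME a. a \<in> X)) (carrier (quotient_heap H S))"
  have h: "h (subheap_rel H S `` {a}) = f a" if "a \<in> carrier H" for a
  proof -
    have "a \<in> subheap_rel H S `` {a}"
      using equiv_class_self[OF equiv that] .
    then have "(SOME x. x \<in> subheap_rel H S `` {a}) \<in> subheap_rel H S `` {a}"
      by (rule someI)
    then have "f (SOME x. x \<in> subheap_rel H S `` {a}) = f a"
      using f_eq by auto
    then show ?thesis
      using that by (simp add: h_def carrier_quotient quotientI)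
  qed
  have "h \<in> heap_hom (quotient_heap H S) K"
    unfolding heap_hom_def
  proof (intro CollectI conjI ballI Pi_I)
    fix X assume "X \<in> carrier (quotient_heap H S)"
    then show "h X \<in> carrier K"
      by (auto simp: carrier_quotient h f_carrier elim!: quotientE)
  next
    fix X Y Z
    assume "X \<in> carrier (quotient_heap H S)" "Y \<in> carrier (quotient_heap H S)"
      "Z \<in> carrier (quotient_heap H S)"
    then show "h (bracket (quotient_heap H S) X Y Z) = bracket K (h X) (h Y) (h Z)"
      by (auto simp: carrier_quotient h f_bracket closed bracket_quotient[OF assms(1,2)]
          elim!: quotientE)
  qed
  moreover have "h \<in> extensional (carrier (quotient_heap H S))"
    by (simp add: h_def)
  ultimately show thesis
    using that h by blast
qed

end

section \<open>Words and signed letters\<close>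

text \<open>The letters of a word together with a sign, which is \<open>True\<close> for the letters in odd positions
  (even indices, as lists are indexed from 0) and \<open>False\<close> for those in even positions.\<close>

definition signed_letters :: "'x list \<Rightarrow> (bool \<times> 'x) list" where
  "signed_letters w = map (\<lambda>i. (even i, w ! i)) [0..<length w]"

text \<open>Reversal of all signs; it describes the effect of a shift of a word by an odd number of
  positions.\<close>

definition flip :: "(bool \<times> 'x) list \<Rightarrow> (bool \<times> 'x) list" where
  "flip = map (apfst Not)"

lemma flip_Nil [simp]: "flip [] = []"
  and flip_Cons [simp]: "flip ((b, x) # l) = (\<not> b, x) # flip l"
  and flip_append [simp]: "flip (l @ l') = flip l @ flip l'"
  and mset_flip: "mset (flip l) = image_mset (apfst Not) (mset l)"
  by (simp_all add: flip_def)

lemma flip_flip [simp]: "flip (flip l) = l"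
  by (induction l) auto

lemma snd_flip [simp]: "snd ` set (flip l) = snd ` set l"
  by (simp add: flip_def image_image)

lemma signed_letters_Nil [simp]: "signed_letters [] = []"
  by (simp add: signed_letters_def)

lemma signed_letters_Cons [simp]:
  "signed_letters (x # w) = (True, x) # flip (signed_letters w)"
  by (simp add: signed_letters_def flip_def map_upt_Suc comp_def del: upt_Suc)

lemma signed_letters_append:
  "signed_letters (u @ v) =
    signed_letters u @ (if even (length u) then signed_letters v else flip (signed_letters v))"
  by (induction u) auto

lemma length_signed_letters [simp]: "length (signed_letters w) = length w"
  by (simp add: signed_letters_def)

lemma snd_signed_letters [simp]: "snd ` set (signed_letters w) = set w"
  by (induction w) auto

lemma mem_signed_letters:
  "p \<in> set (signed_letters w) \<longleftrightarrow> (\<exists>i<length w. p = (even i, w ! i))"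
  unfolding signed_letters_def set_map set_upt image_iff Bex_def atLeastLessThan_iff by simp

lemma mset_signed_letters:
  "mset (signed_letters w) = image_mset (\<lambda>i. (even i, w ! i)) (mset_set {..<length w})"
  by (simp add: signed_letters_def atLeast0LessThan)

text \<open>A symmetric word is determined by the multiset of its signed letters: every bijection that matches
  signed letters preserves the parity of indices.\<close>

lemma mem_symword_iff:
  "w' \<in> symword w \<longleftrightarrow> mset (signed_letters w') = mset (signed_letters w)"
proof
  assume "w' \<in> symword w"
  then obtain p where p: "p permutes {..<length w}" "\<And>i. even (p i) \<longleftrightarrow> even i"
    and w': "w' = permute_list p w"
    by (auto simp: symword_def)
  have "mset (signed_letters w') = image_mset (\<lambda>i. (even i, w' ! i)) (mset_set {..<length w})"
    by (simp add: mset_signed_letters w')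
  also have "\<dots> = image_mset ((\<lambda>i. (even i, w ! i)) \<circ> p) (mset_set {..<length w})"
    by (rule image_mset_cong) (auto simp: w' p permute_list_nth)
  also have "\<dots> = mset (signed_letters w)"
    by (simp add: mset_signed_letters permutes_image[OF p(1)] permutes_inj_on[OF p(1)]
        image_mset_mset_set flip: multiset.map_comp)
  finally show "mset (signed_letters w') = mset (signed_letters w)" .
next
  assume eq: "mset (signed_letters w') = mset (signed_letters w)"
  then have len: "length w' = length w"
    by (metis length_signed_letters size_mset)
  have "image_mset (\<lambda>i. (even i, w' ! i)) (mset_set {..<length w}) =
      image_mset (\<lambda>i. (even i, w ! i)) (mset_set {..<length w})"
    using eq by (simp add: mset_signed_letters len)
  then obtain p where p: "p permutes {..<length w}"
    and p': "\<forall>i\<in>{..<length w}. (even i, w' ! i) = (even (p i), w ! p i)"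
    by (rule image_mset_eq_implies_permutes[rotated]) auto
  have "even (p i) \<longleftrightarrow> even i" for i
    using p' permutes_not_in[OF p, of i] by (cases "i < length w") auto
  moreover have "w' = permute_list p w"
    using p' by (intro nth_equalityI) (auto simp: len permute_list_nth[OF p])
  ultimately show "w' \<in> symword w"
    using p by (auto simp: symword_def)
qed

lemma self_mem_symword [simp]: "w \<in> symword w"
  by (simp add: mem_symword_iff)

lemma symword_eq_iff:
  "symword w = symword w' \<longleftrightarrow> mset (signed_letters w) = mset (signed_letters w')"
proof
  assume "symword w = symword w'"
  then have "w \<in> symword w'"
    using self_mem_symword[of w] by simp
  then show "mset (signed_letters w) = mset (signed_letters w')"
    by (simp add: mem_symword_iff)
qed (simp add: set_eq_iff mem_symword_iff)

text \<open>The multiplicity of a letter, counted with sign, in a list of signed letters.\<close>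

definition net_count :: "(bool \<times> 'x) list \<Rightarrow> 'x \<Rightarrow> int" where
  "net_count l x = int (count (mset l) (True, x)) - int (count (mset l) (False, x))"

lemma net_count_Nil [simp]: "net_count [] x = 0"
  and net_count_Cons:
    "net_count (p # l) x = (if p = (True, x) then 1 else if p = (False, x) then -1 else 0)
      + net_count l x"
  and net_count_append [simp]: "net_count (l @ l') x = net_count l x + net_count l' x"
  by (auto simp: net_count_def)

lemma net_count_flip [simp]: "net_count (flip l) x = - net_count l x"
  by (induction l) (auto simp: net_count_Cons)

abbreviation word_count :: "'x list \<Rightarrow> 'x \<Rightarrow> int" where
  "word_count w \<equiv> net_count (signed_letters w)"

lemma word_count_concat:
  assumes "odd (length u)" "odd (length v)"
  shows "word_count (u @ v @ w) = (\<lambda>x. word_count u x - word_count v x + word_count w x)"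
  using assms by (auto simp: signed_letters_append)

section \<open>Reduced symmetric words and pruning\<close>

text \<open>In a reduced symmetric word no letter occurs with both signs.\<close>

lemma reduced_symword_disjoint:
  assumes "reduced (symword w)" "(True, x) \<in> set (signed_letters w)"
  shows "(False, x) \<notin> set (signed_letters w)"
proof
  assume "(False, x) \<in> set (signed_letters w)"
  then obtain j where j: "j < length w" "odd j" "w ! j = x"
    by (auto simp: mem_signed_letters)
  obtain i where i: "i < length w" "even i" "w ! i = x"
    using assms(2) by (auto simp: mem_signed_letters)
  obtain k where k: "j = Suc k"
    using j(2) by (cases j) auto
  \<comment> \<open>The index \<open>k\<close> is even, so exchanging \<open>i\<close> and \<open>k\<close> stays in the symmetric word and makes the two
    occurrences of \<open>x\<close> adjacent.\<close>
  define p where "p = transpose i k"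
  have p: "p permutes {..<length w}"
    unfolding p_def using i j k by (intro permutes_swap_id) auto
  moreover have "even (p n) \<longleftrightarrow> even n" for n
    using i j k by (auto simp: p_def transpose_def)
  ultimately have "permute_list p w \<in> symword w"
    by (auto simp: symword_def)
  then have "distinct_adj (permute_list p w)"
    using assms(1) by (simp add: reduced_def)
  moreover have "Suc k \<noteq> i"
    using i j k by auto
  then have "permute_list p w ! k = x" "permute_list p w ! Suc k = x"
    using i j k permute_list_nth[OF p, of k] permute_list_nth[OF p, of "Suc k"]
    by (simp_all add: p_def transpose_def)
  ultimately show False
    using j k by (auto simp: distinct_adj_conv_nth)
qed

lemma reduced_symword_eqI:
  assumes "reduced (symword w)" "reduced (symword w')" "word_count w = word_count w'"
  shows "symword w = symword w'"
proof -
  have "count (mset (signed_letters w)) (True, x) = count (mset (signed_letters w')) (True, x) \<and>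
      count (mset (signed_letters w)) (False, x) = count (mset (signed_letters w')) (False, x)" for x
  proof -
    have "count (mset (signed_letters w)) (True, x) = 0 \<or>
        count (mset (signed_letters w)) (False, x) = 0"
      using reduced_symword_disjoint[OF assms(1), of x] by (auto simp: count_eq_zero_iff)
    moreover have "count (mset (signed_letters w')) (True, x) = 0 \<or>
        count (mset (signed_letters w')) (False, x) = 0"
      using reduced_symword_disjoint[OF assms(2), of x] by (auto simp: count_eq_zero_iff)
    moreover have "word_count w x = word_count w' x"
      using assms(3) by simp
    ultimately show ?thesis
      unfolding net_count_def by linarith
  qed
  then have "mset (signed_letters w) = mset (signed_letters w')"
    by (intro multiset_eqI) (metis (full_types) surj_pair)
  then show ?thesis
    by (simp add: symword_eq_iff)
qed

lemma symword_properties: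
  assumes "w' \<in> symword w"
  shows "length w' = length w" "set w' = set w" "word_count w' = word_count w"
  using assms mset_eq_setD[of "signed_letters w'" "signed_letters w"]
    mset_eq_length[of "signed_letters w'" "signed_letters w"]
    snd_signed_letters[of w'] snd_signed_letters[of w]
  by (auto simp: mem_symword_iff net_count_def fun_eq_iff)

lemma prune_step_symword:
  assumes "prune_step (symword w) W"
  obtains v where "W = symword v" "length w = length v + 2" "set v \<subseteq> set w"
    "word_count v = word_count w"
proof -
  obtain u x v where *: "u @ [x, x] @ v \<in> symword w" "W = symword (u @ v)"
    using assms by (auto simp: prune_step_def)
  have "word_count (u @ v) = word_count (u @ [x, x] @ v)"
    by (rule ext) (auto simp: signed_letters_append net_count_Cons)
  then show thesis
    using that[of "u @ v"] symword_properties[OF *(1)] *(2) by auto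
qed

lemma prune_steps_symword:
  assumes "prune_step\<^sup>*\<^sup>* (symword w) W"
  shows "\<exists>v. W = symword v \<and> even (length v) = even (length w) \<and> set v \<subseteq> set w \<and>
    word_count v = word_count w"
  using assms
proof (induction rule: rtranclp_induct)
  case base
  then show ?case by auto
next
  case (step W W')
  then obtain v where v: "W = symword v" "even (length v) = even (length w)" "set v \<subseteq> set w"
    "word_count v = word_count w"
    by auto
  obtain v' where "W' = symword v'" "length v = length v' + 2" "set v' \<subseteq> set v"
    "word_count v' = word_count v"
    using prune_step_symword step.hyps(2) v(1) by metis
  with v show ?case
    by (intro exI[of _ v']) auto
qed

lemma ex_reduced: "\<exists>R. prune_step\<^sup>*\<^sup>* (symword w) R \<and> reduced R"
proof (induction w rule: measure_induct_rule[of length])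
  case (less w)
  show ?case
  proof (cases "reduced (symword w)")
    case False
    then obtain w' i where w': "w' \<in> symword w" "Suc i < length w'" "w' ! i = w' ! Suc i"
      by (auto simp: reduced_def distinct_adj_conv_nth)
    have "[w' ! i, w' ! Suc i] @ drop (Suc (Suc i)) w' = drop i w'"
      using w'(2) by (simp add: Cons_nth_drop_Suc)
    then have "take i w' @ [w' ! i, w' ! i] @ drop (Suc (Suc i)) w' = w'"
      using w'(3) by simp
    then have "prune_step (symword w) (symword (take i w' @ drop (Suc (Suc i)) w'))"
      unfolding prune_step_def using w'(1) by (intro exI conjI) (auto intro: back_subst)
    moreover have "length (take i w' @ drop (Suc (Suc i)) w') < length w"
      using w'(2) symword_properties(1)[OF w'(1)] by simp
    ultimately show ?thesis
      using less.IH by (meson converse_rtranclp_into_rtranclp)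
  qed auto
qed

text \<open>The element of the free Abelian heap that is represented by a word of odd length: the result of
  pruning its symmetric word.\<close>

definition word_class :: "'x list \<Rightarrow> 'x list set" where
  "word_class w = prune (symword w)"

text \<open>Pruning is well defined: by \<open>reduced_symword_eqI\<close> a reduced symmetric word reached by pruning is
  determined by the net count, which no pruning step changes.\<close>

lemma word_class_reduced_word:
  obtains r where "word_class w = symword r" "reduced (symword r)"
    "even (length r) = even (length w)" "set r \<subseteq> set w" "word_count r = word_count w"
proof -
  obtain R where R: "prune_step\<^sup>*\<^sup>* (symword w) R" "reduced R"
    using ex_reduced by blast
  have unique: "R' = R" if "prune_step\<^sup>*\<^sup>* (symword w) R'" "reduced R'" for R'
  proof -
    obtain v where "R = symword v" "word_count v = word_count w"
      using prune_steps_symword[OF R(1)] by auto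
    moreover from prune_steps_symword[OF that(1)]
    obtain v' where "R' = symword v'" "word_count v' = word_count w"
      by auto
    ultimately show ?thesis
      using reduced_symword_eqI[of v' v] R(2) that(2) by simp
  qed
  have "word_class w = R"
    unfolding word_class_def prune_def
  proof (rule the_equality)
    show "prune_step\<^sup>*\<^sup>* (symword w) R \<and> reduced R"
      using R by (rule conjI)
  qed (elim conjE, rule unique)
  moreover obtain v where "R = symword v" "even (length v) = even (length w)" "set v \<subseteq> set w"
    "word_count v = word_count w"
    using prune_steps_symword[OF R(1)] by blast
  ultimately show thesis
    using that[of v] R(2) by simp
qed

lemma word_class_eq_iff: "word_class w = word_class w' \<longleftrightarrow> word_count w = word_count w'"
proof -
  obtain r where r: "word_class w = symword r" "reduced (symword r)"
    "even (length r) = even (length w)" "set r \<subseteq> set w"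
    "word_count r = word_count w"
    by (rule word_class_reduced_word)
  obtain r' where r': "word_class w' = symword r'" "reduced (symword r')"
    "even (length r') = even (length w')" "set r' \<subseteq> set w'"
    "word_count r' = word_count w'"
    by (rule word_class_reduced_word)
  show ?thesis
  proof
    assume "word_class w = word_class w'"
    then have "r \<in> symword r'"
      using r(1) r'(1) by (simp add: mem_symword_iff symword_eq_iff)
    then show "word_count w = word_count w'"
      using r(5) r'(5) symword_properties(3)[of r r'] by simp
  next
    assume "word_count w = word_count w'"
    then show "word_class w = word_class w'"
      unfolding r(1) r'(1) using r(2,5) r'(2,5) by (intro reduced_symword_eqI) simp_all
  qed
qed

lemma word_class_reduced:
  assumes "reduced (symword w)"
  shows "word_class w = symword w"
proof -
  obtain r where r: "word_class w = symword r" "reduced (symword r)"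
    "even (length r) = even (length w)" "set r \<subseteq> set w"
    "word_count r = word_count w"
    by (rule word_class_reduced_word)
  then show ?thesis
    using reduced_symword_eqI[of r w] assms by simp
qed

lemma word_class_letter: "word_class [x] = symword [x]"
proof (rule word_class_reduced)
  show "reduced (symword [x])"
    using symword_properties(1)[of _ "[x]"] by (fastforce simp: reduced_def length_Suc_conv)
qed

lemma mem_word_class:
  assumes "v \<in> word_class w"
  shows "word_count v = word_count w" "even (length v) = even (length w)" "set v \<subseteq> set w"
proof -
  obtain r where r: "word_class w = symword r" "reduced (symword r)"
    "even (length r) = even (length w)" "set r \<subseteq> set w"
    "word_count r = word_count w"
    by (rule word_class_reduced_word)
  then show "word_count v = word_count w" "even (length v) = even (length w)" "set v \<subseteq> set w"
    using symword_properties[of v r] assms by auto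
qed

lemma word_class_nonempty: "word_class w \<noteq> {}"
proof -
  obtain r where r: "word_class w = symword r" "reduced (symword r)"
    "even (length r) = even (length w)" "set r \<subseteq> set w"
    "word_count r = word_count w"
    by (rule word_class_reduced_word)
  then show ?thesis
    using self_mem_symword[of r] by (metis empty_iff)
qed

section \<open>The free Abelian heap\<close>

lemma word_class_in_free:
  assumes "odd (length w)" "set w \<subseteq> X"
  shows "word_class w \<in> carrier (free_abelian_heap X)"
proof -
  obtain r where r: "word_class w = symword r" "reduced (symword r)"
    "even (length r) = even (length w)" "set r \<subseteq> set w"
    "word_count r = word_count w"
    by (rule word_class_reduced_word)
  then show ?thesis
    using assms by (auto simp: free_abelian_heap_def symmetric_words_def intro!: exI[of _ r])
qed

lemma free_cases:
  assumes "U \<in> carrier (free_abelian_heap X)"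
  obtains w where "U = word_class w" "odd (length w)" "set w \<subseteq> X"
proof -
  obtain w where "U = symword w" "odd (length w)" "set w \<subseteq> X" "reduced U"
    using assms by (auto simp: free_abelian_heap_def symmetric_words_def)
  then show thesis
    using that[of w] word_class_reduced[of w] by simp
qed

lemma bracket_free:
  assumes "odd (length u)" "odd (length v)" "odd (length w)"
  shows "bracket (free_abelian_heap X) (word_class u) (word_class v) (word_class w) =
    word_class (u @ v @ w)"
proof -
  obtain u' where u': "word_class u = symword u'" "reduced (symword u')"
    "even (length u') = even (length u)" "set u' \<subseteq> set u"
    "word_count u' = word_count u"
    by (rule word_class_reduced_word)
  obtain v' where v': "word_class v = symword v'" "reduced (symword v')"
    "even (length v') = even (length v)" "set v' \<subseteq> set v"
    "word_count v' = word_count v"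
    by (rule word_class_reduced_word)
  obtain w' where w': "word_class w = symword w'" "reduced (symword w')"
    "even (length w') = even (length w)" "set w' \<subseteq> set w"
    "word_count w' = word_count w"
    by (rule word_class_reduced_word)
  have "symword (x @ y @ z) = symword (u' @ v' @ w')"
    if "x \<in> symword u'" "y \<in> symword v'" "z \<in> symword w'" for x y z
    using that symword_properties(1)[OF that(1)] symword_properties(1)[OF that(2)]
    by (simp add: symword_eq_iff signed_letters_append mem_symword_iff mset_flip)
  moreover have "u' \<in> symword u'" "v' \<in> symword v'" "w' \<in> symword w'"
    by simp_all
  ultimately have "(\<Union>x\<in>symword u'. \<Union>y\<in>symword v'. \<Union>z\<in>symword w'. symword (x @ y @ z)) =
      symword (u' @ v' @ w')"
    by blast
  then have "bracket (free_abelian_heap X) (word_class u) (word_class v) (word_class w) =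
      word_class (u' @ v' @ w')"
    by (simp add: free_abelian_heap_def u'(1) v'(1) w'(1) word_class_def[of "u' @ v' @ w'"])
  also have "\<dots> = word_class (u @ v @ w)"
    using assms u' v' w' by (simp add: word_class_eq_iff word_count_concat)
  finally show ?thesis .
qed

lemma abelian_heap_free: "abelian_heap (free_abelian_heap X)"
proof
  let ?F = "free_abelian_heap X"
  fix a b c assume "a \<in> carrier ?F" "b \<in> carrier ?F" "c \<in> carrier ?F"
  then show "bracket ?F a b c \<in> carrier ?F"
    by (elim free_cases) (auto simp: bracket_free intro!: word_class_in_free)
next
  let ?F = "free_abelian_heap X"
  fix a b c d e
  assume "a \<in> carrier ?F" "b \<in> carrier ?F" "c \<in> carrier ?F" "d \<in> carrier ?F" "e \<in> carrier ?F"
  then show "bracket ?F (bracket ?F a b c) d e = bracket ?F a b (bracket ?F c d e)"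
    by (elim free_cases) (simp add: bracket_free)
next
  let ?F = "free_abelian_heap X"
  fix a b
  assume "a \<in> carrier ?F" "b \<in> carrier ?F"
  then show "bracket ?F a b b = a" "bracket ?F b b a = a"
    by (elim free_cases; simp add: bracket_free word_class_eq_iff word_count_concat)+
next
  let ?F = "free_abelian_heap X"
  fix a b c
  assume "a \<in> carrier ?F" "b \<in> carrier ?F" "c \<in> carrier ?F"
  then show "bracket ?F a b c = bracket ?F c b a"
    by (elim free_cases) (simp add: bracket_free word_class_eq_iff word_count_concat algebra_simps)
qed

section \<open>Evaluation of words in an Abelian heap\<close>

text \<open>The signed sum of the images under \<open>g\<close> of a list of signed letters, in the Abelian group with
  zero \<open>z\<close> and sum \<open>[a, z, b]\<close>. There \<open>[z, g x, a]\<close> is \<open>a\<close> minus \<open>g x\<close>.\<close>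

fun signed_sum :: "'h ternary \<Rightarrow> 'h \<Rightarrow> ('x \<Rightarrow> 'h) \<Rightarrow> (bool \<times> 'x) list \<Rightarrow> 'h" where
  "signed_sum H z g [] = z"
| "signed_sum H z g ((True, x) # l) = bracket H (g x) z (signed_sum H z g l)"
| "signed_sum H z g ((False, x) # l) = bracket H z (g x) (signed_sum H z g l)"

text \<open>An Abelian heap with a base point \<open>z\<close> and an assignment \<open>g\<close> of elements to the letters in
  \<open>X\<close>.\<close>

locale letter_evaluation = abelian_heap H for H :: "'h ternary" +
  fixes z :: 'h and g :: "'x \<Rightarrow> 'h" and X :: "'x set"
  assumes base: "z \<in> carrier H" and letters: "x \<in> X \<Longrightarrow> g x \<in> carrier H"
begin

abbreviation eval :: "(bool \<times> 'x) list \<Rightarrow> 'h" where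
  "eval \<equiv> signed_sum H z g"

lemma eval_closed: "snd ` set l \<subseteq> X \<Longrightarrow> eval l \<in> carrier H"
proof (induction l)
  case (Cons p l)
  then show ?case
    by (cases p; cases "fst p") (auto simp: closed base letters)
qed (simp add: base)

lemma eval_append:
  assumes "snd ` set l \<subseteq> X" "snd ` set l' \<subseteq> X"
  shows "eval (l @ l') = bracket H (eval l) z (eval l')"
  using assms
proof (induction l)
  case (Cons p l)
  then show ?case
    by (cases p; cases "fst p") (auto simp: assoc base letters eval_closed)
qed (simp add: base eval_closed left_cancel)

lemma eval_flip:
  assumes "snd ` set l \<subseteq> X"
  shows "eval (flip l) = bracket H z (eval l) z"
  using assms
proof (induction l)
  case (Cons p l)
  obtain b x where p: "p = (b, x)"
    by fastforce
  have mem: "g x \<in> carrier H" "eval l \<in> carrier H"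
    using Cons.prems by (auto simp: p letters eval_closed)
  have IH: "eval (flip l) = bracket H z (eval l) z"
    using Cons by simp
  show ?case
  proof (cases b)
    case True
    have "bracket H z (bracket H (g x) z (eval l)) z = bracket H z (eval l) (bracket H z (g x) z)"
      using mem base by (simp add: bracket_middle)
    also have "\<dots> = bracket H (bracket H z (eval l) z) (g x) z"
      using mem base by (simp add: assoc)
    also have "\<dots> = bracket H z (g x) (bracket H z (eval l) z)"
      using mem base by (simp add: comm closed)
    finally show ?thesis
      using True by (simp add: p IH)
  next
    case False
    have "bracket H z (bracket H z (g x) (eval l)) z = bracket H z (eval l) (bracket H (g x) z z)"
      using mem base by (simp add: bracket_middle)
    also have "\<dots> = bracket H (g x) (eval l) z"
      using mem base comm[of z "eval l" "g x"] by (simp add: right_cancel)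
    also have "\<dots> = bracket H (g x) z (bracket H z (eval l) z)"
      using mem base assoc[of "g x" z z "eval l" z] by (simp add: right_cancel)
    finally show ?thesis
      using False by (simp add: p IH)
  qed
qed (simp add: base right_cancel)

lemma eval_cancel:
  assumes "snd ` set l \<subseteq> X" "snd ` set l' \<subseteq> X" "x \<in> X"
  shows "eval ((b, x) # l @ (\<not> b, x) # l') = eval (l @ l')"
proof -
  have mem: "g x \<in> carrier H" "eval l \<in> carrier H" "eval l' \<in> carrier H"
    using assms by (auto simp: letters eval_closed)
  have snd': "snd ` set ((\<not> b, x) # l') \<subseteq> X"
    using assms by simp
  show ?thesis
  proof (cases b)
    case True
    have "bracket H (g x) z (bracket H (eval l) z (bracket H z (g x) (eval l'))) =
        bracket H (g x) z (bracket H (eval l) (g x) (eval l'))"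
      using mem base assoc[of "eval l" z z "g x" "eval l'"] by (simp add: right_cancel)
    also have "\<dots> = bracket H (bracket H (eval l) z (g x)) (g x) (eval l')"
      using mem base assoc[of "g x" z "eval l" "g x" "eval l'"] comm[of "g x" z "eval l"] by simp
    also have "\<dots> = bracket H (eval l) z (eval l')"
      using mem base by (simp add: assoc left_cancel)
    finally show ?thesis
      using True eval_append[OF assms(1) snd'] eval_append[OF assms(1,2)] by simp
  next
    case False
    have "bracket H z (g x) (bracket H (eval l) z (bracket H (g x) z (eval l'))) =
        bracket H (bracket H (eval l) (g x) z) z (bracket H (g x) z (eval l'))"
      using mem base assoc[of z "g x" "eval l" z] comm[of z "g x" "eval l"] by (simp add: closed)
    also have "\<dots> = bracket H (eval l) (g x) (bracket H (g x) z (eval l'))"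
      using mem base by (simp add: assoc left_cancel closed)
    also have "\<dots> = bracket H (eval l) z (eval l')"
      using mem base assoc[of "eval l" "g x" "g x" z "eval l'"] by (simp add: right_cancel)
    finally show ?thesis
      using False eval_append[OF assms(1) snd'] eval_append[OF assms(1,2)] by simp
  qed
qed

lemma eval_balanced:
  assumes "snd ` set l \<subseteq> X" "\<And>x. net_count l x = 0"
  shows "eval l = z"
  using assms
proof (induction l rule: measure_induct_rule[of length])
  case (less l)
  show ?case
  proof (cases l)
    case (Cons p l')
    obtain b x where p: "p = (b, x)"
      by fastforce
    have "(\<not> b, x) \<in> set l'"
    proof (rule ccontr)
      assume "(\<not> b, x) \<notin> set l'"
      then have "count (mset l') (\<not> b, x) = 0"
        by (simp add: count_eq_zero_iff)
      then have "net_count l x \<noteq> 0"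
        by (cases b) (simp_all add: Cons p net_count_def del: count_mset_0_iff)
      then show False
        using less.prems(2) by simp
    qed
    then obtain l1 l2 where l': "l' = l1 @ (\<not> b, x) # l2"
      by (meson split_list)
    have "net_count (l1 @ l2) y = 0" for y
      using less.prems(2)[of y] by (cases b) (auto simp: Cons p l' net_count_Cons split: if_splits)
    then have "eval (l1 @ l2) = z"
      using less.prems(1) by (intro less.IH) (auto simp: Cons l')
    then show ?thesis
      using eval_cancel[of l1 l2 x b] less.prems(1) by (simp add: Cons p l' image_Un)
  qed simp
qed

lemma eval_eqI:
  assumes "snd ` set l \<subseteq> X" "snd ` set l' \<subseteq> X" "net_count l = net_count l'"
  shows "eval l = eval l'"
proof -
  have mem: "eval l \<in> carrier H" "eval l' \<in> carrier H"
    using assms by (simp_all add: eval_closed)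
  have "bracket H (eval l) (eval l') z = bracket H (eval l) z (bracket H z (eval l') z)"
    using mem base assoc[of "eval l" z z "eval l'" z] by (simp add: right_cancel)
  also have "\<dots> = eval (l @ flip l')"
    using assms by (simp add: eval_append eval_flip)
  also have "\<dots> = z"
    using assms by (intro eval_balanced) (simp_all add: image_Un)
  finally have "bracket H (bracket H (eval l) (eval l') z) z (eval l') = eval l'"
    using mem base by (simp add: left_cancel)
  then show ?thesis
    using mem base by (simp add: assoc left_cancel right_cancel)
qed

text \<open>On words of odd length the alternating sum does not depend on the base point: it turns
  concatenation into the bracket of \<open>H\<close>.\<close>

lemma eval_concat:
  assumes "odd (length u)" "odd (length v)" "set u \<subseteq> X" "set v \<subseteq> X" "set w \<subseteq> X"
  shows "eval (signed_letters (u @ v @ w)) = bracket H (eval (signed_letters u))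
    (eval (signed_letters v)) (eval (signed_letters w))"
proof -
  let ?u = "eval (signed_letters u)" and ?v = "eval (signed_letters v)"
  let ?w = "eval (signed_letters w)"
  have mem: "?u \<in> carrier H" "?v \<in> carrier H" "?w \<in> carrier H"
    using assms by (simp_all add: eval_closed)
  have "eval (signed_letters (u @ v @ w)) =
      bracket H ?u z (bracket H (bracket H z ?v z) z ?w)"
    using assms by (simp add: signed_letters_append eval_append eval_flip image_Un)
  also have "\<dots> = bracket H ?u z (bracket H z ?v ?w)"
    using mem base by (simp add: assoc left_cancel)
  also have "\<dots> = bracket H ?u ?v ?w"
    using mem base assoc[of ?u z z ?v ?w] by (simp add: right_cancel)
  finally show ?thesis .
qed

lemma free_extension:
  obtains f where "f \<in> heap_hom (free_abelian_heap X) H"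
    "\<And>x. x \<in> X \<Longrightarrow> f (symword [x]) = g x"
proof -
  \<comment> \<open>All words in \<open>U\<close> have the same net count, so the choice does not affect the value.\<close>
  define f where "f = (\<lambda>U. eval (signed_letters (SOME u. u \<in> U)))"
  have f: "f (word_class w) = eval (signed_letters w)" if "set w \<subseteq> X" for w
  proof -
    have "(SOME u. u \<in> word_class w) \<in> word_class w"
      using word_class_nonempty some_in_eq by blast
    from mem_word_class[OF this] that show ?thesis
      unfolding f_def by (intro eval_eqI) auto
  qed
  have "f \<in> heap_hom (free_abelian_heap X) H"
    unfolding heap_hom_def
  proof (intro CollectI conjI ballI Pi_I)
    fix U assume "U \<in> carrier (free_abelian_heap X)"
    then show "f U \<in> carrier H"
      by (elim free_cases) (simp add: f eval_closed)
  next
    fix U V W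
    assume "U \<in> carrier (free_abelian_heap X)" "V \<in> carrier (free_abelian_heap X)"
      "W \<in> carrier (free_abelian_heap X)"
    then show "f (bracket (free_abelian_heap X) U V W) = bracket H (f U) (f V) (f W)"
      by (elim free_cases) (simp add: bracket_free f eval_concat)
  qed
  moreover have "f (symword [x]) = g x" if "x \<in> X" for x
    using f[of "[x]"] that base letters by (simp add: word_class_letter right_cancel)
  ultimately show thesis
    using that by blast
qed

end

lemma letter_in_free: "x \<in> X \<Longrightarrow> symword [x] \<in> carrier (free_abelian_heap X)"
  using word_class_in_free[of "[x]" X] by (simp add: word_class_letter)

lemma free_hom_eqI:
  assumes "f \<in> heap_hom (free_abelian_heap X) K" "f' \<in> heap_hom (free_abelian_heap X) K"
    and "\<And>x. x \<in> X \<Longrightarrow> f (symword [x]) = f' (symword [x])"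
    and "U \<in> carrier (free_abelian_heap X)"
  shows "f U = f' U"
proof -
  have "f (word_class w) = f' (word_class w)" if "odd (length w)" "set w \<subseteq> X" for w
    using that
  proof (induction w rule: induct_list012)
    case (2 x)
    then show ?case
      using assms(3) by (simp add: word_class_letter)
  next
    case (3 x y w)
    have "word_class (x # y # w) =
        bracket (free_abelian_heap X) (symword [x]) (symword [y]) (word_class w)"
      using bracket_free[of "[x]" "[y]" w X] 3 by (simp add: word_class_letter)
    moreover have "symword [x] \<in> carrier (free_abelian_heap X)"
      "symword [y] \<in> carrier (free_abelian_heap X)"
      "word_class w \<in> carrier (free_abelian_heap X)"
      using 3 by (simp_all add: letter_in_free word_class_in_free)
    ultimately show ?case
      using assms(1,2) assms(3)[of x] assms(3)[of y] 3 by (simp add: heap_hom_def)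
  qed simp
  then show ?thesis
    using assms(4) by (elim free_cases) simp
qed

section \<open>Generated sub-heaps and the direct sum\<close>

lemma generated_subheap_superset: "G \<subseteq> generated_subheap H G"
  by (auto simp: generated_subheap_def)

lemma generated_subheap_least: "subheap S H \<Longrightarrow> G \<subseteq> S \<Longrightarrow> generated_subheap H G \<subseteq> S"
  by (auto simp: generated_subheap_def)

lemma (in heap) subheap_generated:
  assumes "G \<subseteq> carrier H"
  shows "subheap (generated_subheap H G) H"
proof -
  have "subheap (carrier H) H"
    by (auto simp: subheap_def closed)
  then have "generated_subheap H G \<subseteq> carrier H"
    using assms by (rule generated_subheap_least)
  then show ?thesis
    by (auto simp: subheap_def generated_subheap_def)
qed

text \<open>The fibre of a heap morphism over a point is a sub-heap.\<close>

lemma hom_constant_on_generated: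
  assumes "heap H" "heap K" "f \<in> heap_hom H K" "G \<subseteq> carrier H" "\<And>x. x \<in> G \<Longrightarrow> f x = c"
    and "x \<in> generated_subheap H G"
  shows "f x = c"
proof -
  have "subheap {x \<in> carrier H. f x = c} H"
    using assms(3) heap.closed[OF assms(1)] heap.right_cancel[OF assms(2), of c c]
    by (auto simp: subheap_def heap_hom_def Pi_iff)
  then have "generated_subheap H G \<subseteq> {x \<in> carrier H. f x = c}"
    using assms(4,5) by (intro generated_subheap_least) auto
  then show ?thesis
    using assms(6) by auto
qed

lemma heap_hom_comp:
  "f \<in> heap_hom H K \<Longrightarrow> f' \<in> heap_hom K L \<Longrightarrow> (\<lambda>x. f' (f x)) \<in> heap_hom H L"
  by (auto simp: heap_hom_def Pi_iff)

text \<open>The direct sum of two Abelian heaps that are not both empty. In the empty case there is no base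
  element \<open>e\<close>.\<close>

locale nonempty_sum = A: abelian_heap A + B: abelian_heap B
  for A :: "'a ternary" and B :: "'b ternary" +
  fixes e :: "('a + 'b) list set"
  assumes nonempty: "carrier A \<noteq> {} \<or> carrier B \<noteq> {}"
    and e: "e \<in> carrier (sum_free A B)"
begin

abbreviation "F \<equiv> sum_free A B"
abbreviation "C \<equiv> sum_subheap A B e"

text \<open>The generators of the sub-heap that is divided out. They express that the bracket of one-letter
  words agrees with the bracket in \<open>A\<close> or in \<open>B\<close>.\<close>

definition relators :: "('a + 'b) list set set" where
  "relators =
    {bracket F (bracket F (symword [Inl a]) (symword [Inl a']) (symword [Inl a'']))
        (symword [Inl (bracket A a a' a'')]) e
      | a a' a''. a \<in> carrier A \<and> a' \<in> carrier A \<and> a'' \<in> carrier A} \<union>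
     {bracket F (bracket F (symword [Inr b]) (symword [Inr b']) (symword [Inr b'']))
        (symword [Inr (bracket B b b' b'')]) e
      | b b' b''. b \<in> carrier B \<and> b' \<in> carrier B \<and> b'' \<in> carrier B}"

sublocale F: abelian_heap F
  unfolding sum_free_def by (rule abelian_heap_free)

lemma sum_subheap_eq: "C = generated_subheap F relators"
  by (simp add: sum_subheap_def relators_def)

lemma letter_left: "a \<in> carrier A \<Longrightarrow> symword [Inl a] \<in> carrier F"
  and letter_right: "b \<in> carrier B \<Longrightarrow> symword [Inr b] \<in> carrier F"
  by (auto simp: sum_free_def intro: letter_in_free)

lemma relators_closed: "relators \<subseteq> carrier F"
  using e by (auto simp: relators_def intro!: F.closed letter_left letter_right A.closed B.closed)

lemma subheap_C: "subheap C F"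
  unfolding sum_subheap_eq by (rule F.subheap_generated[OF relators_closed])

lemma relators_subset: "relators \<subseteq> C"
  unfolding sum_subheap_eq by (rule generated_subheap_superset)

lemma left_relator:
  assumes "a \<in> carrier A" "a' \<in> carrier A" "a'' \<in> carrier A"
  shows "bracket F (bracket F (symword [Inl a]) (symword [Inl a']) (symword [Inl a'']))
    (symword [Inl (bracket A a a' a'')]) e \<in> C"
  using assms by (intro subsetD[OF relators_subset], unfold relators_def) (rule UnI1, blast)

lemma right_relator:
  assumes "b \<in> carrier B" "b' \<in> carrier B" "b'' \<in> carrier B"
  shows "bracket F (bracket F (symword [Inr b]) (symword [Inr b']) (symword [Inr b'']))
    (symword [Inr (bracket B b b' b'')]) e \<in> C"
  using assms by (intro subsetD[OF relators_subset], unfold relators_def) (rule UnI2, blast)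

text \<open>By \<open>[a, a, a] = a\<close> the relator of a constant triple is \<open>e\<close>.\<close>

lemma e_in_C: "e \<in> C"
  using nonempty
proof
  assume "carrier A \<noteq> {}"
  then obtain a where "a \<in> carrier A"
    by auto
  then show ?thesis
    using left_relator[of a a a] e
    by (simp add: A.right_cancel F.right_cancel F.left_cancel letter_left)
next
  assume "carrier B \<noteq> {}"
  then obtain b where "b \<in> carrier B"
    by auto
  then show ?thesis
    using right_relator[of b b b] e
    by (simp add: B.right_cancel F.right_cancel F.left_cancel letter_right)
qed

lemma C_nonempty: "C \<noteq> {}"
  using e_in_C by auto

lemma direct_sum_eq: "direct_sum A B e = quotient_heap F C"
  using nonempty by (auto simp: direct_sum_def)

lemma abelian_heap_direct_sum: "abelian_heap (direct_sum A B e)"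
  unfolding direct_sum_eq using subheap_C C_nonempty by (rule F.abelian_heap_quotient)

lemma class_in_direct_sum:
  "U \<in> carrier F \<Longrightarrow> subheap_rel F C `` {U} \<in> carrier (direct_sum A B e)"
  by (simp add: direct_sum_eq F.carrier_quotient quotientI)

lemma inj_left_hom: "inj_left A B e \<in> heap_hom A (direct_sum A B e)"
  unfolding heap_hom_def
proof (intro CollectI conjI ballI Pi_I)
  fix a assume "a \<in> carrier A"
  then show "inj_left A B e a \<in> carrier (direct_sum A B e)"
    by (simp add: inj_left_def class_in_direct_sum letter_left)
next
  fix a a' a'' assume a: "a \<in> carrier A" "a' \<in> carrier A" "a'' \<in> carrier A"
  have "(bracket F (symword [Inl a]) (symword [Inl a']) (symword [Inl a'']),
      symword [Inl (bracket A a a' a'')]) \<in> subheap_rel F C"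
    unfolding F.subheap_rel_iff[OF subheap_C e_in_C]
    using a left_relator by (simp add: F.closed A.closed letter_left)
  from equiv_class_eq[OF F.equiv_subheap_rel[OF subheap_C C_nonempty] this]
  show "inj_left A B e (bracket A a a' a'') = bracket (direct_sum A B e) (inj_left A B e a)
      (inj_left A B e a') (inj_left A B e a'')"
    using a by (simp add: inj_left_def direct_sum_eq F.bracket_quotient[OF subheap_C C_nonempty]
        letter_left)
qed

lemma inj_right_hom: "inj_right A B e \<in> heap_hom B (direct_sum A B e)"
  unfolding heap_hom_def
proof (intro CollectI conjI ballI Pi_I)
  fix b assume "b \<in> carrier B"
  then show "inj_right A B e b \<in> carrier (direct_sum A B e)"
    by (simp add: inj_right_def class_in_direct_sum letter_right)
next
  fix b b' b'' assume b: "b \<in> carrier B" "b' \<in> carrier B" "b'' \<in> carrier B"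
  have "(bracket F (symword [Inr b]) (symword [Inr b']) (symword [Inr b'']),
      symword [Inr (bracket B b b' b'')]) \<in> subheap_rel F C"
    unfolding F.subheap_rel_iff[OF subheap_C e_in_C]
    using b right_relator by (simp add: F.closed B.closed letter_right)
  from equiv_class_eq[OF F.equiv_subheap_rel[OF subheap_C C_nonempty] this]
  show "inj_right A B e (bracket B b b' b'') = bracket (direct_sum A B e) (inj_right A B e b)
      (inj_right A B e b') (inj_right A B e b'')"
    using b by (simp add: inj_right_def direct_sum_eq F.bracket_quotient[OF subheap_C C_nonempty]
        letter_right)
qed

text \<open>The morphism out of the direct sum that is induced by \<open>\<phi>\<close> and \<open>\<psi>\<close>.\<close>

lemma ex_copairing:
  assumes "abelian_heap H" "\<phi> \<in> heap_hom A H" "\<psi> \<in> heap_hom B H"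
  obtains f where "f \<in> heap_hom (direct_sum A B e) H"
    "f \<in> extensional (carrier (direct_sum A B e))"
    "\<And>a. a \<in> carrier A \<Longrightarrow> f (inj_left A B e a) = \<phi> a"
    "\<And>b. b \<in> carrier B \<Longrightarrow> f (inj_right A B e b) = \<psi> b"
proof -
  interpret H: abelian_heap H by fact
  have carrier: "\<And>a. a \<in> carrier A \<Longrightarrow> \<phi> a \<in> carrier H"
    "\<And>b. b \<in> carrier B \<Longrightarrow> \<psi> b \<in> carrier H"
    using assms(2,3) by (auto simp: heap_hom_def)
  then obtain z where z: "z \<in> carrier H"
    using nonempty by blast
  interpret letter_evaluation H z "case_sum \<phi> \<psi>" "carrier A <+> carrier B"
    by unfold_locales (use z carrier in \<open>auto\<close>)
  obtain f where f: "f \<in> heap_hom F H"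
    and f_letter: "\<And>x. x \<in> carrier A <+> carrier B \<Longrightarrow> f (symword [x]) = case_sum \<phi> \<psi> x"
    unfolding sum_free_def using free_extension by blast
  have f_left: "f (symword [Inl a]) = \<phi> a" if "a \<in> carrier A" for a
    using f_letter[OF InlI[OF that]] by simp
  have f_right: "f (symword [Inr b]) = \<psi> b" if "b \<in> carrier B" for b
    using f_letter[OF InrI[OF that]] by simp
  have f_bracket: "f (bracket F U V W) = bracket H (f U) (f V) (f W)"
    if "U \<in> carrier F" "V \<in> carrier F" "W \<in> carrier F" for U V W
    using f that by (simp add: heap_hom_def)
  have fe: "f e \<in> carrier H"
    using f e by (auto simp: heap_hom_def)
  have "f U = f e" if "U \<in> relators" for U
    using that unfolding relators_def
  proof (elim UnE CollectE exE conjE)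
    fix a a' a'' assume "a \<in> carrier A" "a' \<in> carrier A" "a'' \<in> carrier A"
      and "U = bracket F (bracket F (symword [Inl a]) (symword [Inl a']) (symword [Inl a'']))
        (symword [Inl (bracket A a a' a'')]) e"
    moreover from this have "\<phi> (bracket A a a' a'') = bracket H (\<phi> a) (\<phi> a') (\<phi> a'')"
      using assms(2) by (simp add: heap_hom_def)
    ultimately show "f U = f e"
      using e fe by (simp add: f_bracket f_left letter_left A.closed F.closed carrier H.closed
          H.left_cancel)
  next
    fix b b' b'' assume "b \<in> carrier B" "b' \<in> carrier B" "b'' \<in> carrier B"
      and "U = bracket F (bracket F (symword [Inr b]) (symword [Inr b']) (symword [Inr b'']))
        (symword [Inr (bracket B b b' b'')]) e"
    moreover from this have "\<psi> (bracket B b b' b'') = bracket H (\<psi> b) (\<psi> b') (\<psi> b'')"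
      using assms(3) by (simp add: heap_hom_def)
    ultimately show "f U = f e"
      using e fe by (simp add: f_bracket f_right letter_right B.closed F.closed carrier H.closed
          H.left_cancel)
  qed
  then have "f U = f e" if "U \<in> C" for U
    using hom_constant_on_generated[OF F.heap_axioms H.heap_axioms f relators_closed] that
    unfolding sum_subheap_eq by blast
  then have const: "f U = f V" if "U \<in> C" "V \<in> C" for U V
    using that by simp
  obtain h where h: "h \<in> heap_hom (quotient_heap F C) H"
    "h \<in> extensional (carrier (quotient_heap F C))"
    "\<And>U. U \<in> carrier F \<Longrightarrow> h (subheap_rel F C `` {U}) = f U"
    using F.hom_factors_through_quotient[OF subheap_C C_nonempty H.heap_axioms f const] by blast
  show thesis
  proof (rule that)
    show "h (inj_left A B e a) = \<phi> a" if "a \<in> carrier A" for a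
      using that by (simp add: inj_left_def h(3) letter_left f_left)
    show "h (inj_right A B e b) = \<psi> b" if "b \<in> carrier B" for b
      using that by (simp add: inj_right_def h(3) letter_right f_right)
  qed (use h(1,2) in \<open>simp_all add: direct_sum_eq\<close>)
qed

lemma copairing_unique:
  assumes "f \<in> heap_hom (direct_sum A B e) H" "f' \<in> heap_hom (direct_sum A B e) H"
    and "f \<in> extensional (carrier (direct_sum A B e))"
    and "f' \<in> extensional (carrier (direct_sum A B e))"
    and left: "\<And>a. a \<in> carrier A \<Longrightarrow> f (inj_left A B e a) = f' (inj_left A B e a)"
    and right: "\<And>b. b \<in> carrier B \<Longrightarrow> f (inj_right A B e b) = f' (inj_right A B e b)"
  shows "f = f'"
proof (rule extensionalityI[OF assms(3,4)])
  let ?q = "\<lambda>U. subheap_rel F C `` {U}"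
  fix Q assume "Q \<in> carrier (direct_sum A B e)"
  then obtain U where U: "U \<in> carrier F" "Q = ?q U"
    by (auto simp: direct_sum_eq F.carrier_quotient elim: quotientE)
  have q: "?q \<in> heap_hom F (direct_sum A B e)"
    unfolding direct_sum_eq using subheap_C C_nonempty by (rule F.quotient_map_hom)
  have "f (?q U) = f' (?q U)"
  proof (rule free_hom_eqI)
    show "(\<lambda>U. f (?q U)) \<in> heap_hom (free_abelian_heap (carrier A <+> carrier B)) H"
      using heap_hom_comp[OF q assms(1)] by (simp add: sum_free_def)
    show "(\<lambda>U. f' (?q U)) \<in> heap_hom (free_abelian_heap (carrier A <+> carrier B)) H"
      using heap_hom_comp[OF q assms(2)] by (simp add: sum_free_def)
    show "U \<in> carrier (free_abelian_heap (carrier A <+> carrier B))"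
      using U(1) by (simp add: sum_free_def)
    show "f (?q (symword [x])) = f' (?q (symword [x]))" if "x \<in> carrier A <+> carrier B" for x
      using that left right by (auto simp: inj_left_def inj_right_def)
  qed
  then show "f Q = f' Q"
    by (simp add: U(2))
qed

end

theorem proposition3p7:
  fixes A :: "'a ternary" and B :: "'b ternary" and e :: "('a + 'b) list set"
  assumes "abelian_heap A" and "abelian_heap B"
    and "carrier A \<noteq> {} \<or> carrier B \<noteq> {} \<Longrightarrow> e \<in> carrier (sum_free A B)"
  shows "abelian_heap (direct_sum A B e)
    \<and> inj_left A B e \<in> heap_hom A (direct_sum A B e)
    \<and> inj_right A B e \<in> heap_hom B (direct_sum A B e)
    \<and> (\<forall>(H :: 'h ternary) \<phi> \<psi>.
        abelian_heap H \<longrightarrow> \<phi> \<in> heap_hom A H \<longrightarrow> \<psi> \<in> heap_hom B H \<longrightarrow>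
        (\<exists>!f. f \<in> heap_hom (direct_sum A B e) H \<and> f \<in> extensional (carrier (direct_sum A B e))
          \<and> (\<forall>a\<in>carrier A. f (inj_left A B e a) = \<phi> a)
          \<and> (\<forall>b\<in>carrier B. f (inj_right A B e b) = \<psi> b)))"
proof (cases "carrier A = {} \<and> carrier B = {}")
  case True
  then have D: "direct_sum A B e = \<lparr>carrier = {}, bracket = (\<lambda>_ _ _. undefined)\<rparr>"
    by (simp add: direct_sum_def)
  have "abelian_heap (direct_sum A B e)"
    by unfold_locales (simp_all add: D)
  moreover have "\<exists>!f. f \<in> heap_hom (direct_sum A B e) H
      \<and> f \<in> extensional (carrier (direct_sum A B e))"
    for H :: "'h ternary"
    by (auto simp: D heap_hom_def)
  ultimately show ?thesis
    using True by (simp add: heap_hom_def)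
next
  case False
  then interpret nonempty_sum A B e
    using assms by (auto simp: nonempty_sum_def nonempty_sum_axioms_def)
  have "\<exists>!f. f \<in> heap_hom (direct_sum A B e) H
      \<and> f \<in> extensional (carrier (direct_sum A B e))
      \<and> (\<forall>a\<in>carrier A. f (inj_left A B e a) = \<phi> a)
      \<and> (\<forall>b\<in>carrier B. f (inj_right A B e b) = \<psi> b)"
    if H: "abelian_heap H" "\<phi> \<in> heap_hom A H" "\<psi> \<in> heap_hom B H"
    for H :: "'h ternary" and \<phi> \<psi>
  proof (rule ex_ex1I)
    show "\<exists>f. f \<in> heap_hom (direct_sum A B e) H \<and> f \<in> extensional (carrier (direct_sum A B e))
        \<and> (\<forall>a\<in>carrier A. f (inj_left A B e a) = \<phi> a)
        \<and> (\<forall>b\<in>carrier B. f (inj_right A B e b) = \<psi> b)"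
      using ex_copairing[OF H] by metis
  qed (auto intro!: copairing_unique)
  then show ?thesis
    using abelian_heap_direct_sum inj_left_hom inj_right_hom by blast
qed

end
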